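(* Consider the online setting on $k$ vertices with the metric $\ell_{ij}=1$ for all $i\neq j$, and with demand sequences in which the demand at any vertex and time does not exceed $1/\rho$, where $1\le\rho\le k$. No online algorithm (randomized algorithms included) can achieve a competitive ratio better (greater) than $O\left(\sqrt{\rho/k}\right)$; that is, there is an absolute constant $c$ such that for all such $k,\rho$ the competitive ratio of every online algorithm is at most $c\sqrt{\rho/k}$.
   Context: $V$ is a set of $k$ vertices with distances $\ell_{ij}$. Time steps are $1,\dots,T$. A demand sequence is $d=(d^1,\dots,d^T)$ and a supply sequence is $s=(s^1,\dots,s^T)$, where each $d^t,s^t$ is a nonnegative vector indexed by $V$ with entries summing to $1$. The demand served at time $t$ is $\mathrm{ds}(s^t,d^t)=\sum_i\min(s^t_i,d^t_i)$. The earthmover distance $\mathrm{em}(s,s')$ is the minimum of $\sum_{u,v}f(u,v)\ell_{uv}$ over all $f\ge 0$ with $\sum_v f(u,v)=s_u$, $\sum_u f(u,v)=s'_v$. The social welfare is $\mathrm{sw}(s,d)=\sum_{t=1}^T\mathrm{ds}(s^t,d^t)-\sum_{t=2}^T\mathrm{em}(s^{t-1},s^t)$. An online algorithm $\mathrm{Alg}$ chooses $s^t$ as a (possibly randomized) function of $d^1,\dots,d^t$. Its competitive ratio is the worst case (infimum), over demand sequences $d$ in the considered class (of any length $T$), of $\mathrm{sw}(\mathrm{Alg}(d),d)/\max_s\mathrm{sw}(s,d)$, with the numerator replaced by its expectation for randomized algorithms. *)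

theory Defs
  imports "HOL-Probability.Probability"
begin

text \<open>Nonnegative vectors indexed by \<open>V\<close> with entries summing to 1. Vectors are total functions that
  vanish outside \<open>V\<close>, so that equal vectors are equal functions; in particular an online algorithm,
  which is a function of demand vectors, cannot see anything beyond the entries on \<open>V\<close>.\<close>
definition unit_vectors :: "'v set \<Rightarrow> ('v \<Rightarrow> real) set" where
  "unit_vectors V = {x. (\<forall>v\<in>V. 0 \<le> x v) \<and> (\<forall>v. v \<notin> V \<longrightarrow> x v = 0) \<and> (\<Sum>v\<in>V. x v) = 1}"

definition demand_served :: "'v set \<Rightarrow> ('v \<Rightarrow> real) \<Rightarrow> ('v \<Rightarrow> real) \<Rightarrow> real" where
  "demand_served V s d = (\<Sum>i\<in>V. min (s i) (d i))"

definition flows :: "'v set \<Rightarrow> ('v \<Rightarrow> real) \<Rightarrow> ('v \<Rightarrow> real) \<Rightarrow> ('v \<Rightarrow> 'v \<Rightarrow> real) set" where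
  "flows V s s' = {f. (\<forall>u\<in>V. \<forall>v\<in>V. 0 \<le> f u v) \<and>
     (\<forall>u\<in>V. (\<Sum>v\<in>V. f u v) = s u) \<and> (\<forall>v\<in>V. (\<Sum>u\<in>V. f u v) = s' v)}"

text \<open>For finite \<open>V\<close> and unit vectors \<open>s\<close>, \<open>s'\<close> the infimum is a minimum (a linear function on a
  nonempty compact polytope).\<close>
definition earthmover :: "'v set \<Rightarrow> ('v \<Rightarrow> 'v \<Rightarrow> real) \<Rightarrow> ('v \<Rightarrow> real) \<Rightarrow> ('v \<Rightarrow> real) \<Rightarrow> real" where
  "earthmover V l s s' = (INF f\<in>flows V s s'. \<Sum>u\<in>V. \<Sum>v\<in>V. f u v * l u v)"

text \<open>Sequences are lists of common length \<open>T\<close>, so time \<open>t\<close> of the mathematics is list index \<open>t - 1\<close>.\<close>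
definition social_welfare ::
  "'v set \<Rightarrow> ('v \<Rightarrow> 'v \<Rightarrow> real) \<Rightarrow> ('v \<Rightarrow> real) list \<Rightarrow> ('v \<Rightarrow> real) list \<Rightarrow> real" where
  "social_welfare V l s d =
     (\<Sum>t<length d. demand_served V (s ! t) (d ! t))
     - (\<Sum>t=1..<length d. earthmover V l (s ! (t - 1)) (s ! t))"

text \<open>The supremum is a maximum for finite \<open>V\<close>: the welfare is continuous in the supply sequence,
  which ranges over a compact set.\<close>
definition optimal_welfare ::
  "'v set \<Rightarrow> ('v \<Rightarrow> 'v \<Rightarrow> real) \<Rightarrow> ('v \<Rightarrow> real) list \<Rightarrow> real" where
  "optimal_welfare V l d =
     (SUP s\<in>{s. length s = length d \<and> set s \<subseteq> unit_vectors V}. social_welfare V l s d)"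

text \<open>Demand sequences have length at least 1; for the empty sequence the ratio would be 0 / 0.\<close>
definition demand_sequences :: "('v \<Rightarrow> real) set \<Rightarrow> ('v \<Rightarrow> real) list set" where
  "demand_sequences D = {d. d \<noteq> [] \<and> set d \<subseteq> D}"

type_synonym 'v algorithm = "('v \<Rightarrow> real) list \<Rightarrow> ('v \<Rightarrow> real)"

text \<open>A deterministic online algorithm for demand vectors from \<open>D\<close> maps the demands \<open>d\<^sup>1, \<dots>, d\<^sup>t\<close>
  seen so far to the supply vector of time \<open>t\<close>.\<close>
definition online_algorithms :: "'v set \<Rightarrow> ('v \<Rightarrow> real) set \<Rightarrow> 'v algorithm set" where
  "online_algorithms V D = {A. \<forall>h\<in>demand_sequences D. A h \<in> unit_vectors V}"

definition supply_of :: "'v algorithm \<Rightarrow> ('v \<Rightarrow> real) list \<Rightarrow> ('v \<Rightarrow> real) list" where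
  "supply_of A d = map (\<lambda>t. A (take (Suc t) d)) [0..<length d]"

text \<open>A randomized online algorithm is a random deterministic one, i.e. a probability measure on
  deterministic online algorithms for which each supply entry is a random variable. This covers an
  algorithm driven by random bits \<open>\<omega>\<close> from an arbitrary probability space (push the measure
  forward along \<open>\<omega> \<mapsto> A\<^sub>\<omega>\<close>), without a type variable for that space; point masses are the
  deterministic algorithms.\<close>
definition randomized_online_algorithm ::
  "'v set \<Rightarrow> ('v \<Rightarrow> real) set \<Rightarrow> 'v algorithm measure \<Rightarrow> bool" where
  "randomized_online_algorithm V D M \<longleftrightarrow>
     prob_space M \<and> space M \<subseteq> online_algorithms V D \<and>
     (\<forall>h\<in>demand_sequences D. \<forall>v\<in>V. (\<lambda>A. A h v) \<in> borel_measurable M)"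

text \<open>The infimum is taken in the extended reals because the welfare of a bad algorithm can be negative
  and the ratios need not be bounded below.\<close>
definition competitive_ratio ::
  "'v set \<Rightarrow> ('v \<Rightarrow> 'v \<Rightarrow> real) \<Rightarrow> ('v \<Rightarrow> real) set \<Rightarrow> 'v algorithm measure \<Rightarrow> ereal" where
  "competitive_ratio V l D M =
     (INF d\<in>demand_sequences D.
        ereal ((\<integral>A. social_welfare V l (supply_of A d) d \<partial>M) / optimal_welfare V l d))"

definition uniform_metric :: "'v \<Rightarrow> 'v \<Rightarrow> real" where
  "uniform_metric u v = (if u = v then 0 else 1)"

definition capped_demands :: "'v set \<Rightarrow> real \<Rightarrow> ('v \<Rightarrow> real) set" where
  "capped_demands V \<rho> = {d\<in>unit_vectors V. \<forall>v\<in>V. d v \<le> 1 / \<rho>}"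

end

theory Submission
  imports Defs
begin

text \<open>Group the vertices into \<open>h\<^sup>2\<close> blocks of \<open>n = \<lceil>\<rho>\<rceil>\<close> vertices, where \<open>h \<approx> sqrt (k / n)\<close>, and let every
  demand be uniform on one block. Moving towards the current demand costs as much as it gains, so an
  online algorithm earns at time \<open>t\<close> at most the supply that it already held at time \<open>t - 1\<close> on the
  demanded block. The adversary knows the expected supply. In each window of \<open>h + 1\<close> steps it first
  demands \<open>h\<close> distinct blocks whose expected supply is at most \<open>1 / (h\<^sup>2 - h + 1)\<close>, and then repeats the
  one among them with the least expected supply, which is at most \<open>1 / h\<close>. So the algorithm earns
  \<open>O(1 / h)\<close> per window, whereas sitting for the whole window on the repeated block earns 2 at a
  moving cost of at most 1.\<close>

section \<open>Unit vectors and the earthmover distance\<close>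

lemma unit_vectors_nonneg: "x \<in> unit_vectors V \<Longrightarrow> 0 \<le> x v"
  by (cases "v \<in> V") (auto simp: unit_vectors_def)

lemma unit_vectors_sum: "x \<in> unit_vectors V \<Longrightarrow> sum x V = 1"
  by (simp add: unit_vectors_def)

lemma unit_vectors_sum_le:
  assumes "finite V" "x \<in> unit_vectors V" "S \<subseteq> V"
  shows "sum x S \<le> 1"
  using sum_mono2[OF assms(1,3), of x] assms(2)
  by (simp add: unit_vectors_nonneg unit_vectors_sum)

lemma demand_served_le_1:
  assumes "s \<in> unit_vectors V"
  shows "demand_served V s d \<le> 1"
proof -
  have "demand_served V s d \<le> sum s V"
    unfolding demand_served_def by (intro sum_mono) auto
  then show ?thesis using assms by (simp add: unit_vectors_sum)
qed

lemma demand_served_nonneg: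
  assumes "s \<in> unit_vectors V" "d \<in> unit_vectors V"
  shows "0 \<le> demand_served V s d"
  unfolding demand_served_def
  by (intro sum_nonneg) (use assms in \<open>auto simp: unit_vectors_nonneg\<close>)

text \<open>The independent coupling. It shows that the set of flows is nonempty, without which
  lower bounds on the real infimum would be out of reach, and its total mass 1 bounds the distance
  by 1.\<close>

lemma product_flow:
  assumes "s \<in> unit_vectors V" "s' \<in> unit_vectors V"
  shows "(\<lambda>u v. s u * s' v) \<in> flows V s s'"
  using assms
  by (auto simp: flows_def unit_vectors_nonneg unit_vectors_sum
      simp flip: sum_distrib_left sum_distrib_right)

lemma uniform_cost_nonneg:
  assumes "f \<in> flows V s s'"
  shows "0 \<le> (\<Sum>u\<in>V. \<Sum>v\<in>V. f u v * uniform_metric u v)"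
  by (intro sum_nonneg) (use assms in \<open>auto simp: flows_def uniform_metric_def\<close>)

lemma earthmover_le:
  assumes "f \<in> flows V s s'"
  shows "earthmover V uniform_metric s s' \<le> (\<Sum>u\<in>V. \<Sum>v\<in>V. f u v * uniform_metric u v)"
  unfolding earthmover_def
  by (rule cINF_lower[OF _ assms], rule bdd_belowI2[where m = 0]) (rule uniform_cost_nonneg)

lemma earthmover_nonneg:
  assumes "s \<in> unit_vectors V" "s' \<in> unit_vectors V"
  shows "0 \<le> earthmover V uniform_metric s s'"
  unfolding earthmover_def
  using product_flow[OF assms] by (intro cINF_greatest uniform_cost_nonneg) auto

lemma earthmover_le_1:
  assumes "s \<in> unit_vectors V" "s' \<in> unit_vectors V"
  shows "earthmover V uniform_metric s s' \<le> 1"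
proof -
  have "(\<Sum>u\<in>V. \<Sum>v\<in>V. s u * s' v * uniform_metric u v) \<le> (\<Sum>u\<in>V. \<Sum>v\<in>V. s u * s' v)"
    by (intro sum_mono) (use assms in \<open>auto simp: uniform_metric_def unit_vectors_nonneg\<close>)
  also have "\<dots> = 1"
    using assms by (simp add: unit_vectors_sum flip: sum_distrib_left sum_distrib_right)
  finally show ?thesis
    using earthmover_le[OF product_flow[OF assms]] by linarith
qed

lemma earthmover_refl_le_0:
  assumes "finite V" "s \<in> unit_vectors V"
  shows "earthmover V uniform_metric s s \<le> 0"
proof -
  define f where "f = (\<lambda>u v. if u = v then s u else 0)"
  have "f \<in> flows V s s"
    using assms by (auto simp: flows_def f_def unit_vectors_nonneg)
  from earthmover_le[OF this] have
    "earthmover V uniform_metric s s \<le> (\<Sum>u\<in>V. \<Sum>v\<in>V. f u v * uniform_metric u v)" .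
  also have "\<dots> = 0"
    by (intro sum.neutral ballI) (simp add: f_def uniform_metric_def)
  finally show ?thesis .
qed

text \<open>Under a flow \<open>f\<close>, the supply at \<open>v\<close> after the move consists of
  \<open>f v v\<close>, which was already there, and of mass from other vertices, which costs 1 per
  unit in the uniform metric. Hence the served demand grows by no more than the cost of
  \<open>f\<close>.\<close>

lemma demand_served_move:
  assumes "finite V" "s \<in> unit_vectors V" "s' \<in> unit_vectors V"
  shows "demand_served V s' d - earthmover V uniform_metric s s' \<le> demand_served V s d"
proof -
  have "demand_served V s' d - demand_served V s d \<le> earthmover V uniform_metric s s'"
    unfolding earthmover_def
  proof (rule cINF_greatest)
    show "flows V s s' \<noteq> {}" using product_flow[OF assms(2,3)] by auto
  next
    fix f assume f: "f \<in> flows V s s'"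
    have "min (s' v) (d v) - min (s v) (d v) \<le> (\<Sum>u\<in>V. f u v * uniform_metric u v)"
      if v: "v \<in> V" for v
    proof -
      have "s' v = (\<Sum>u\<in>V. f u v)" using f v by (simp add: flows_def)
      also have "\<dots> = f v v + (\<Sum>u\<in>V - {v}. f u v)"
        using assms(1) v by (simp add: sum.remove)
      also have "(\<Sum>u\<in>V - {v}. f u v) = (\<Sum>u\<in>V. f u v * uniform_metric u v)"
        using assms(1) v by (simp add: sum.remove uniform_metric_def)
      finally have s': "s' v = f v v + (\<Sum>u\<in>V. f u v * uniform_metric u v)" .
      have "f v v \<le> (\<Sum>u\<in>V. f v u)"
        using f v assms(1) by (intro member_le_sum) (auto simp: flows_def)
      also have "\<dots> = s v" using f v by (simp add: flows_def)
      finally have "f v v \<le> s v" .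
      \<comment> \<open>Nonnegative inflow is needed because \<open>min\<close> with
        \<open>d v\<close> may cut off part of it: raising an argument of \<open>min\<close> by some
        amount raises the minimum by at most that amount.\<close>
      moreover have "0 \<le> (\<Sum>u\<in>V. f u v * uniform_metric u v)"
        by (intro sum_nonneg) (use f v in \<open>auto simp: flows_def uniform_metric_def\<close>)
      ultimately show ?thesis using s' by linarith
    qed
    then have "demand_served V s' d - demand_served V s d
        \<le> (\<Sum>v\<in>V. \<Sum>u\<in>V. f u v * uniform_metric u v)"
      unfolding demand_served_def sum_subtractf[symmetric] by (intro sum_mono)
    then show "demand_served V s' d - demand_served V s d
        \<le> (\<Sum>u\<in>V. \<Sum>v\<in>V. f u v * uniform_metric u v)"
      by (subst sum.swap)
  qed
  then show ?thesis by linarith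
qed

section \<open>The welfare of online and offline supply sequences\<close>

text \<open>Each step serves at most 1 and moving never earns. This makes the supremum in
  \<open>optimal_welfare\<close> one over a set bounded above.\<close>

lemma social_welfare_le_length:
  assumes "length s = length d" "set s \<subseteq> unit_vectors V"
  shows "social_welfare V uniform_metric s d \<le> real (length d)"
proof -
  have s: "s ! t \<in> unit_vectors V" if "t < length d" for t
    using that assms nth_mem by (metis subsetD)
  have "(\<Sum>t<length d. demand_served V (s ! t) (d ! t)) \<le> (\<Sum>t<length d. 1)"
    by (intro sum_mono demand_served_le_1 s) auto
  moreover have "0 \<le> (\<Sum>t=1..<length d. earthmover V uniform_metric (s ! (t - 1)) (s ! t))"
    by (intro sum_nonneg earthmover_nonneg s) auto
  ultimately show ?thesis unfolding social_welfare_def by simp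
qed

lemma social_welfare_le_optimal:
  assumes "length s = length d" "set s \<subseteq> unit_vectors V"
  shows "social_welfare V uniform_metric s d \<le> optimal_welfare V uniform_metric d"
  unfolding optimal_welfare_def
  by (rule cSUP_upper, use assms in simp, rule bdd_aboveI2[where M = "real (length d)"])
    (simp add: social_welfare_le_length)

text \<open>By \<open>demand_served_move\<close>, the cost of moving at index \<open>t\<close>
  cancels whatever the move gains for \<open>d ! t\<close>. What remains is earned by
  \<open>A (take t d)\<close>, the supply at index \<open>t - 1\<close>, which was fixed before
  \<open>d ! t\<close> was revealed. The first step has no moving cost and contributes the
  1.\<close>

lemma online_welfare_le:
  assumes V: "finite V" and A: "A \<in> online_algorithms V D" and d: "d \<in> demand_sequences D"
  shows "social_welfare V uniform_metric (supply_of A d) d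
    \<le> 1 + (\<Sum>t=1..<length d. demand_served V (A (take t d)) (d ! t))"
proof -
  define T where "T = length d"
  have T: "0 < T" using d by (simp add: T_def demand_sequences_def)
  have s: "A (take t d) \<in> unit_vectors V" if "0 < t" for t
  proof -
    have "take t d \<in> demand_sequences D"
      using d that set_take_subset[of t d] by (auto simp: demand_sequences_def)
    then show ?thesis using A by (simp add: online_algorithms_def)
  qed
  have nth: "supply_of A d ! t = A (take (Suc t) d)" if "t < T" for t
    using that by (simp add: supply_of_def T_def)
  have nth': "supply_of A d ! (t - 1) = A (take t d)" if "t \<in> {1..<T}" for t
    using that nth[of "t - 1"] by (simp add: less_imp_diff_less)
  have "(\<Sum>t<T. demand_served V (supply_of A d ! t) (d ! t))
      = demand_served V (supply_of A d ! 0) (d ! 0)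
        + (\<Sum>t=1..<T. demand_served V (supply_of A d ! t) (d ! t))"
    using T by (simp add: lessThan_atLeast0 sum.atLeast_Suc_lessThan)
  moreover have "demand_served V (supply_of A d ! 0) (d ! 0) \<le> 1"
    using nth[OF T] s[of "Suc 0"] by (simp add: demand_served_le_1)
  moreover have "(\<Sum>t=1..<T. demand_served V (supply_of A d ! t) (d ! t))
      - (\<Sum>t=1..<T. earthmover V uniform_metric (supply_of A d ! (t - 1)) (supply_of A d ! t))
      \<le> (\<Sum>t=1..<T. demand_served V (A (take t d)) (d ! t))"
    unfolding sum_subtractf[symmetric]
  proof (rule sum_mono)
    fix t assume t: "t \<in> {1..<T}"
    then have "supply_of A d ! t = A (take (Suc t) d)" using nth by simp
    then show "demand_served V (supply_of A d ! t) (d ! t)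
        - earthmover V uniform_metric (supply_of A d ! (t - 1)) (supply_of A d ! t)
        \<le> demand_served V (A (take t d)) (d ! t)"
      using nth'[OF t] demand_served_move[OF V s s] t by auto
  qed
  ultimately show ?thesis unfolding social_welfare_def T_def[symmetric] by linarith
qed

text \<open>Offline, the supply stays throughout window \<open>b\<close> on the demand that occurs
  twice in it. This serves at least 2 per window, and moving between windows costs at most 1 each
  time.\<close>

lemma optimal_welfare_windows:
  assumes V: "finite V" and len: "length d = B * L" and d: "set d \<subseteq> unit_vectors V"
    and rep: "\<And>b. b < B \<Longrightarrow> \<exists>i j. i < j \<and> j < L \<and> d ! (b * L + i) = d ! (b * L + j)"
  shows "real B \<le> optimal_welfare V uniform_metric d"
proof -
  have "\<forall>b. \<exists>i j. b < B \<longrightarrow> i < j \<and> j < L \<and> d ! (b * L + i) = d ! (b * L + j)"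
    using rep by blast
  then obtain i j where ij: "\<And>b. b < B \<Longrightarrow> i b < j b \<and> j b < L \<and> d ! (b * L + i b) = d ! (b * L + j b)"
    by metis
  define x where "x = (\<lambda>b. d ! (b * L + i b))"
  define s where "s = map (\<lambda>t. x (t div L)) [0..<B * L]"
  have win: "b * L + r < B * L" if "b < B" "r < L" for b r
  proof -
    have "b * L + r < Suc b * L" using that by simp
    also have "\<dots> \<le> B * L" using that by (intro mult_le_mono1) simp
    finally show ?thesis .
  qed
  have dt: "d ! t \<in> unit_vectors V" if "t < B * L" for t
    using that d len nth_mem by (metis subsetD)
  have x: "x b \<in> unit_vectors V" if "b < B" for b
    unfolding x_def using ij[OF that] that by (intro dt win) auto
  have divB: "t div L < B" if "t < B * L" for t
    using that by (simp add: less_mult_imp_div_less)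
  have st: "s ! t = x (t div L)" if "t < B * L" for t
    using that by (simp add: s_def)
  have sU: "set s \<subseteq> unit_vectors V" by (auto simp: s_def intro!: x divB)
  have gain: "2 \<le> (\<Sum>t\<in>{b * L..<b * L + L}. demand_served V (s ! t) (d ! t))" if b: "b < B" for b
  proof -
    have *: "demand_served V (s ! t) (d ! t) = 1" if "t \<in> {b * L + i b, b * L + j b}" for t
    proof -
      have tr: "t < B * L" "t div L = b" using that ij[OF b] win[OF b] by auto
      have "d ! t = x b" using that ij[OF b] by (auto simp: x_def)
      then have "demand_served V (s ! t) (d ! t) = sum (x b) V"
        using st[OF tr(1)] tr(2) by (simp add: demand_served_def)
      then show ?thesis using x[OF b] by (simp add: unit_vectors_sum)
    qed
    have "2 = (\<Sum>t\<in>{b * L + i b, b * L + j b}. demand_served V (s ! t) (d ! t))"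
      using * ij[OF b] by simp
    also have "\<dots> \<le> (\<Sum>t\<in>{b * L..<b * L + L}. demand_served V (s ! t) (d ! t))"
    proof (rule sum_mono2)
      fix t assume "t \<in> {b * L..<b * L + L} - {b * L + i b, b * L + j b}"
      then have "t < B * L" using win[OF b, of "t - b * L"] by auto
      then show "0 \<le> demand_served V (s ! t) (d ! t)"
        using dt st x divB by (simp add: demand_served_nonneg)
    qed (use ij[OF b] in auto)
    finally show ?thesis .
  qed
  have cost: "earthmover V uniform_metric (s ! (t - 1)) (s ! t) \<le> (if L dvd t then 1 else 0)"
    if t: "t \<in> {1..<B * L}" for t
  proof (cases "L dvd t")
    case True
    then show ?thesis using t st x divB by (auto intro!: earthmover_le_1)
  next
    case False
    \<comment> \<open>Unless \<open>L\<close> divides \<open>t\<close>, the indices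
      \<open>t - 1\<close> and \<open>t\<close> lie in the same window, so the supply does not
      change.\<close>
    obtain u where u: "t = Suc u" using t by (cases t) auto
    have "Suc u div L = u div L"
      using False u by (simp add: div_Suc dvd_eq_mod_eq_0)
    then have "s ! (t - 1) = s ! t" using t u st by simp
    then show ?thesis
      using False t st x divB V by (auto intro!: earthmover_refl_le_0)
  qed
  have "real B * 2 = (\<Sum>b<B. 2)" by simp
  also have "\<dots> \<le> (\<Sum>b<B. \<Sum>t\<in>{b * L..<b * L + L}. demand_served V (s ! t) (d ! t))"
    by (intro sum_mono gain) auto
  also have "\<dots> = (\<Sum>t<B * L. demand_served V (s ! t) (d ! t))" by (rule sum.nat_group)
  finally have g: "real B * 2 \<le> (\<Sum>t<B * L. demand_served V (s ! t) (d ! t))" .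
  have "(\<Sum>t=1..<B * L. earthmover V uniform_metric (s ! (t - 1)) (s ! t))
      \<le> (\<Sum>t=1..<B * L. if L dvd t then 1 else 0)"
    by (intro sum_mono cost)
  \<comment> \<open>Index 0 is added, where no move occurs, so that the range splits evenly into
    windows with at most one multiple of \<open>L\<close> each.\<close>
  also have "\<dots> \<le> (\<Sum>t<B * L. if L dvd t then 1 else (0::real))"
    by (intro sum_mono2) auto
  also have "\<dots> = (\<Sum>b<B. \<Sum>t\<in>{b * L..<b * L + L}. if L dvd t then 1 else 0)"
    by (rule sum.nat_group[symmetric])
  also have "\<dots> \<le> (\<Sum>b<B. 1)"
  proof (rule sum_mono)
    fix b
    have sub: "{t \<in> {b * L..<b * L + L}. L dvd t} \<subseteq> {b * L}"
    proof
      fix t assume t: "t \<in> {t \<in> {b * L..<b * L + L}. L dvd t}"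
      then obtain q where q: "t = L * q" by (auto elim: dvdE)
      have "b * L \<le> q * L" "q * L < Suc b * L" using t q by (auto simp: mult.commute)
      then have "b \<le> q" "q < Suc b" by (metis mult_le_cancel2 mult_less_cancel2 not_le order.strict_trans1, metis mult_less_cancel2)
      then show "t \<in> {b * L}" using q by simp
    qed
    have "(\<Sum>t\<in>{b * L..<b * L + L}. if L dvd t then 1 else (0::real))
        = real (card {t \<in> {b * L..<b * L + L}. L dvd t})"
      by (simp add: sum.If_cases Int_def)
    also have "\<dots> \<le> 1" using card_mono[OF _ sub] by simp
    finally show "(\<Sum>t\<in>{b * L..<b * L + L}. if L dvd t then 1 else (0::real)) \<le> 1" .
  qed
  finally have "(\<Sum>t=1..<B * L. earthmover V uniform_metric (s ! (t - 1)) (s ! t)) \<le> real B"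
    by simp
  with g have "real B \<le> social_welfare V uniform_metric s d"
    unfolding social_welfare_def len by linarith
  also have "\<dots> \<le> optimal_welfare V uniform_metric d"
    using sU len by (intro social_welfare_le_optimal) (auto simp: s_def)
  finally show ?thesis .
qed

section \<open>The adversary\<close>

text \<open>Averaging: the minimum is at most the mean.\<close>

lemma exists_light_element:
  fixes p :: "nat \<Rightarrow> real"
  assumes "finite S" "S \<noteq> {}" "sum p S \<le> 1"
  shows "\<exists>x\<in>S. p x \<le> 1 / real (card S)"
proof (rule ccontr)
  assume "\<not> ?thesis"
  then have "(\<Sum>x\<in>S. 1 / real (card S)) < sum p S"
    using assms by (intro sum_strict_mono) auto
  then show False using assms by simp
qed

text \<open>With \<open>P w x\<close> the expected supply on block \<open>x\<close> after the blocks
  \<open>w\<close> were demanded, this is the adversary's bound on the expected earnings along a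
  sequence of blocks.\<close>

definition history_cost :: "(nat list \<Rightarrow> nat \<Rightarrow> real) \<Rightarrow> nat list \<Rightarrow> real" where
  "history_cost P w = (\<Sum>t<length w. P (take t w) (w ! t))"

lemma history_cost_Nil [simp]: "history_cost P [] = 0"
  by (simp add: history_cost_def)

lemma history_cost_snoc: "history_cost P (w @ [x]) = history_cost P w + P w x"
  by (simp add: history_cost_def nth_append)

text \<open>All that the adversary uses of the algorithm: expected masses on \<open>m\<close>
  disjoint blocks, determined by the history alone. The randomness is already integrated out, so the
  adversary can fix its sequence in advance.\<close>

locale expected_supply =
  fixes m :: nat and P :: "nat list \<Rightarrow> nat \<Rightarrow> real"
  assumes P_nonneg: "\<And>w x. 0 \<le> P w x"
    and P_sum: "\<And>w. set w \<subseteq> {..<m} \<Longrightarrow> (\<Sum>x<m. P w x) \<le> 1"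
begin

lemma light_element:
  assumes "set w \<subseteq> {..<m}" "S \<subseteq> {..<m}" "S \<noteq> {}"
  shows "\<exists>x\<in>S. P w x \<le> 1 / real (card S)"
proof (rule exists_light_element)
  show "finite S" using assms(2) finite_subset by blast
  have "sum (P w) S \<le> (\<Sum>x<m. P w x)"
    using assms(2) by (intro sum_mono2) (auto simp: P_nonneg)
  then show "sum (P w) S \<le> 1" using P_sum[OF assms(1)] by linarith
qed fact

lemma distinct_cheap_extension:
  assumes "set hist \<subseteq> {..<m}" "h \<le> m" "n \<le> h"
  shows "\<exists>w. length w = n \<and> distinct w \<and> set w \<subseteq> {..<m} \<and>
    history_cost P (hist @ w) \<le> history_cost P hist + real n / real (m - h + 1)"
  using assms(3)
proof (induction n)
  case 0
  show ?case by (intro exI[of _ "[]"]) simp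
next
  case (Suc n)
  then obtain w where w: "length w = n" "distinct w" "set w \<subseteq> {..<m}"
    "history_cost P (hist @ w) \<le> history_cost P hist + real n / real (m - h + 1)"
    by auto
  define S where "S = {..<m} - set w"
  have card: "card S = m - n"
    using w by (simp add: S_def card_Diff_subset distinct_card)
  then have "S \<noteq> {}" using Suc.prems assms(2) by auto
  then obtain x where x: "x \<in> S" "P (hist @ w) x \<le> 1 / real (m - n)"
    using light_element[of "hist @ w" S] w assms(1) card by (auto simp: S_def)
  have "1 / real (m - n) \<le> 1 / real (m - h + 1)"
    using Suc.prems assms(2) by (intro divide_left_mono) auto
  then have "history_cost P (hist @ (w @ [x])) \<le> history_cost P hist + real (Suc n) / real (m - h + 1)"
    using w(4) x(2) history_cost_snoc[of P "hist @ w" x] by (simp add: add_divide_distrib)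
  then show ?case
    using w x by (intro exI[of _ "w @ [x]"]) (auto simp: S_def)
qed

text \<open>Once \<open>h\<close> distinct blocks are demanded, they share a supply of at most 1, so
  one of them holds at most \<open>1 / h\<close>. Demanding it again at position \<open>h\<close>
  creates the repetition that the offline supply exploits.\<close>

lemma cheap_window:
  assumes "set hist \<subseteq> {..<m}" "h \<le> m" "0 < h"
  shows "\<exists>w. length w = Suc h \<and> set w \<subseteq> {..<m} \<and> (\<exists>i<h. w ! i = w ! h) \<and>
    history_cost P (hist @ w) \<le> history_cost P hist + (real h / real (m - h + 1) + 1 / real h)"
proof -
  obtain w where w: "length w = h" "distinct w" "set w \<subseteq> {..<m}"
    "history_cost P (hist @ w) \<le> history_cost P hist + real h / real (m - h + 1)"
    using distinct_cheap_extension[OF assms(1,2) order_refl] by blast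
  then obtain x where x: "x \<in> set w" "P (hist @ w) x \<le> 1 / real h"
    using light_element[of "hist @ w" "set w"] assms by (auto simp: distinct_card)
  then obtain i where i: "i < h" "w ! i = x" using w(1) by (auto simp: in_set_conv_nth)
  show ?thesis
    using w x i history_cost_snoc[of P "hist @ w" x]
    by (intro exI[of _ "w @ [x]"]) (auto simp: nth_append intro!: exI[of _ i])
qed

text \<open>The bound of \<open>cheap_window\<close> holds after every history, so windows can be
  concatenated and their costs add up.\<close>

lemma cheap_windows:
  assumes "h \<le> m" "0 < h"
  shows "\<exists>w. length w = B * Suc h \<and> set w \<subseteq> {..<m} \<and>
    (\<forall>b<B. \<exists>i<h. w ! (b * Suc h + i) = w ! (b * Suc h + h)) \<and>
    history_cost P w \<le> real B * (real h / real (m - h + 1) + 1 / real h)"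
proof (induction B)
  case 0
  show ?case by simp
next
  case (Suc B)
  then obtain w where w: "length w = B * Suc h" "set w \<subseteq> {..<m}"
    "\<And>b. b < B \<Longrightarrow> \<exists>i<h. w ! (b * Suc h + i) = w ! (b * Suc h + h)"
    "history_cost P w \<le> real B * (real h / real (m - h + 1) + 1 / real h)"
    by blast
  obtain w' where w': "length w' = Suc h" "set w' \<subseteq> {..<m}" "\<exists>i<h. w' ! i = w' ! h"
    "history_cost P (w @ w') \<le> history_cost P w + (real h / real (m - h + 1) + 1 / real h)"
    using cheap_window[OF w(2) assms] by blast
  have "\<exists>i<h. (w @ w') ! (b * Suc h + i) = (w @ w') ! (b * Suc h + h)" if "b < Suc B" for b
  proof (cases "b = B")
    case True
    then show ?thesis using w'(3) w(1) by (simp add: nth_append)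
  next
    case False
    then have b: "b < B" using that by simp
    obtain i where i: "i < h" "w ! (b * Suc h + i) = w ! (b * Suc h + h)" using w(3)[OF b] by blast
    have "Suc b * Suc h \<le> B * Suc h" using b by (intro mult_le_mono1) simp
    then have "b * Suc h + i < length w" "b * Suc h + h < length w" using i w(1) by simp_all
    then have "(w @ w') ! (b * Suc h + i) = (w @ w') ! (b * Suc h + h)"
      using i(2) by (simp only: nth_append_left)
    then show ?thesis using i(1) by blast
  qed
  \<comment> \<open>The cost per window is abstracted to \<open>c\<close>, which leaves an
    inequality linear in \<open>c\<close>.\<close>
  moreover have "history_cost P (w @ w') \<le> real (Suc B) * c"
    if "c = real h / real (m - h + 1) + 1 / real h" for c
    using w(4) w'(4) unfolding that[symmetric] by (simp add: distrib_right)
  ultimately show ?case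
    using w w' by (intro exI[of _ "w @ w'"]) auto
qed

end

section \<open>Block demands\<close>

text \<open>The blocks are consecutive intervals, so the first \<open>m\<close> of them tile
  \<open>{..<m * n}\<close> and sums over blocks regroup into one sum over vertices.\<close>

definition block_demand :: "nat \<Rightarrow> nat \<Rightarrow> nat \<Rightarrow> real" where
  "block_demand n g v = (if v \<in> {g * n..<g * n + n} then 1 / real n else 0)"

lemma block_subset:
  fixes n m k g :: nat
  assumes "m * n \<le> k" "g < m"
  shows "{g * n..<g * n + n} \<subseteq> {..<k}"
proof -
  have "Suc g * n \<le> m * n" using assms(2) by (intro mult_le_mono1) simp
  then show ?thesis using assms(1) by auto
qed

lemma block_demand_capped:
  assumes "m * n \<le> k" "g < m" "0 < \<rho>" "\<rho> \<le> real n"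
  shows "block_demand n g \<in> capped_demands {..<k} \<rho>"
proof -
  have sub: "{g * n..<g * n + n} \<subseteq> {..<k}" by (rule block_subset[OF assms(1,2)])
  have "(\<Sum>v<k. block_demand n g v) = (\<Sum>v\<in>{g * n..<g * n + n}. 1 / real n)"
    unfolding block_demand_def sum.inter_restrict[OF finite_lessThan, symmetric]
    using sub by (simp only: Int_absorb1)
  also have "\<dots> = 1" using assms by simp
  finally have "(\<Sum>v<k. block_demand n g v) = 1" .
  moreover have "1 / real n \<le> 1 / \<rho>" using assms by (intro divide_left_mono) auto
  ultimately show ?thesis
    using sub assms by (auto simp: capped_demands_def unit_vectors_def block_demand_def)
qed

lemma demand_served_block:
  assumes "m * n \<le> k" "g < m" "s \<in> unit_vectors {..<k}"
  shows "demand_served {..<k} s (block_demand n g) \<le> (\<Sum>v\<in>{g * n..<g * n + n}. s v)"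
proof -
  have "demand_served {..<k} s (block_demand n g)
      \<le> (\<Sum>v<k. if v \<in> {g * n..<g * n + n} then s v else 0)"
    unfolding demand_served_def
    by (intro sum_mono) (auto simp: block_demand_def unit_vectors_nonneg[OF assms(3)])
  also have "\<dots> = (\<Sum>v\<in>{g * n..<g * n + n}. s v)"
    unfolding sum.inter_restrict[OF finite_lessThan, symmetric]
    using block_subset[OF assms(1,2)] by (simp only: Int_absorb1)
  finally show ?thesis .
qed

text \<open>The adversary plays \<open>h\<close> windows on \<open>h ^ 2\<close> blocks. Each window
  yields the algorithm at most \<open>3 / h\<close> in expectation, so 3 in total and 4 with the
  first step, whereas the offline supply earns at least \<open>h\<close>.\<close>

lemma competitive_ratio_le:
  fixes M :: "nat algorithm measure"
  assumes M: "randomized_online_algorithm {..<k} (capped_demands {..<k} \<rho>) M"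
    and \<rho>: "0 < \<rho>" "\<rho> \<le> real n" and h: "0 < h" "h ^ 2 * n \<le> k"
  shows "competitive_ratio {..<k} uniform_metric (capped_demands {..<k} \<rho>) M \<le> ereal (4 / real h)"
proof -
  define D where "D = capped_demands {..<k} \<rho>"
  define m where "m = h ^ 2"
  define L where "L = Suc h"
  have mn: "m * n \<le> k" using h by (simp add: m_def)
  have hm: "h \<le> m" by (simp add: m_def power2_nat_le_imp_le power2_eq_square)
  interpret prob_space M using M by (simp add: randomized_online_algorithm_def)
  have alg: "A \<in> online_algorithms {..<k} D" if "A \<in> space M" for A
    using M that by (auto simp: randomized_online_algorithm_def D_def)
  have meas: "(\<lambda>A. A w v) \<in> borel_measurable M" if "w \<in> demand_sequences D" "v < k" for w v
    using M that by (auto simp: randomized_online_algorithm_def D_def)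
  have unit: "A w \<in> unit_vectors {..<k}" if "A \<in> space M" "w \<in> demand_sequences D" for A w
    using alg[OF that(1)] that(2) by (simp add: online_algorithms_def)
  have int: "integrable M (\<lambda>A. A w v)" if w: "w \<in> demand_sequences D" and v: "v < k" for w v
  proof (rule integrable_const_bound[where B = 1])
    show "AE A in M. norm (A w v) \<le> 1"
    proof (rule AE_I2)
      fix A assume "A \<in> space M"
      from unit[OF this w] have "0 \<le> A w v" "sum (A w) {v} \<le> 1"
        using v by (auto intro!: unit_vectors_sum_le[of "{..<k}"] simp: unit_vectors_nonneg simp del: sum.insert)
      then show "norm (A w v) \<le> 1" by simp
    qed
  qed (rule meas[OF w v])
  have Dseq: "map (block_demand n) w \<in> demand_sequences D" if "set w \<subseteq> {..<m}" "w \<noteq> []" for w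
    using that by (auto simp: demand_sequences_def D_def intro!: block_demand_capped[OF mn _ \<rho>])
  \<comment> \<open>\<open>F A w g\<close> is the supply that \<open>A\<close> holds on block
    \<open>g\<close> after the demands \<open>w\<close>.\<close>
  define F where "F = (\<lambda>A w g. \<Sum>v\<in>{g * n..<g * n + n}. (A :: nat algorithm) (map (block_demand n) w) v)"
  \<comment> \<open>The value 0 at \<open>[]\<close> reflects that no supply precedes the first
    demand, whose gain is the separate 1. On lists with entries outside \<open>{..<m}\<close> the
    demands may leave \<open>D\<close>, where \<open>A\<close> is unconstrained, and 0 keeps
    \<open>P\<close> nonnegative.\<close>
  define P where "P = (\<lambda>w g. if w = [] \<or> \<not> set w \<subseteq> {..<m} then 0 else \<integral>A. F A w g \<partial>M)"
  have intF: "integrable M (\<lambda>A. F A w g)" if "w \<noteq> []" "set w \<subseteq> {..<m}" "g < m" for w g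
    unfolding F_def using Dseq[OF that(2,1)] block_subset[OF mn that(3)]
    by (intro Bochner_Integration.integrable_sum int) auto
  have F_nonneg: "0 \<le> F A w g" if "A \<in> space M" "w \<noteq> []" "set w \<subseteq> {..<m}" for A w g
    unfolding F_def using unit[OF that(1) Dseq[OF that(3,2)]]
    by (intro sum_nonneg) (auto simp: unit_vectors_nonneg)
  interpret expected_supply m P
  proof
    fix w g show "0 \<le> P w g"
      unfolding P_def using F_nonneg by (auto intro!: integral_nonneg_AE)
  next
    fix w assume w: "set w \<subseteq> {..<m}"
    show "(\<Sum>g<m. P w g) \<le> 1"
    proof (cases "w = []")
      case False
      have le: "(\<Sum>g<m. F A w g) \<le> 1" if "A \<in> space M" for A
      proof -
        have "(\<Sum>g<m. F A w g) = (\<Sum>v<m * n. A (map (block_demand n) w) v)"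
          unfolding F_def by (rule sum.nat_group)
        also have "\<dots> \<le> 1"
          using unit[OF that Dseq[OF w False]] mn by (intro unit_vectors_sum_le[of "{..<k}"]) auto
        finally show ?thesis .
      qed
      have "(\<Sum>g<m. P w g) = (\<Sum>g<m. \<integral>A. F A w g \<partial>M)" using False w by (simp add: P_def)
      also have "\<dots> = (\<integral>A. (\<Sum>g<m. F A w g) \<partial>M)"
        using intF[OF False w] by (subst Bochner_Integration.integral_sum) auto
      also have "\<dots> \<le> (\<integral>A. 1 \<partial>M)"
        using intF[OF False w] le by (intro integral_mono) auto
      finally show ?thesis by (simp add: prob_space)
    qed (simp add: P_def)
  qed
  \<comment> \<open>With \<open>h\<close> windows the algorithm's total stays constant, including
    the additive 1, while the optimum grows like \<open>h\<close>.\<close>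
  obtain w where w: "length w = h * L" "set w \<subseteq> {..<m}"
    "\<And>b. b < h \<Longrightarrow> \<exists>i<h. w ! (b * L + i) = w ! (b * L + h)"
    "history_cost P w \<le> real h * (real h / real (m - h + 1) + 1 / real h)"
    using cheap_windows[OF hm h(1), of h] unfolding L_def by blast
  define d where "d = map (block_demand n) w"
  have len: "length d = h * L" by (simp add: d_def w)
  have wne: "w \<noteq> []" using w(1) h by (auto simp: L_def)
  have dD: "d \<in> demand_sequences D" unfolding d_def by (rule Dseq[OF w(2) wne])
  have dU: "set d \<subseteq> unit_vectors {..<k}"
    using dD by (auto simp: demand_sequences_def D_def capped_demands_def)
  have opt: "real h \<le> optimal_welfare {..<k} uniform_metric d"
  proof (rule optimal_welfare_windows[OF _ len dU])
    fix b assume b: "b < h"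
    then have "Suc b * L \<le> h * L" by (intro mult_le_mono1) simp
    then have "b * L + i < length w" if "i < L" for i using that w(1) by simp
    then show "\<exists>i j. i < j \<and> j < L \<and> d ! (b * L + i) = d ! (b * L + j)"
      using w(3)[OF b] unfolding d_def L_def
      by (metis lessI less_SucI nth_map)
  qed simp
  have wt: "take t w \<noteq> []" "set (take t w) \<subseteq> {..<m}" "w ! t < m" if "t \<in> {1..<h * L}" for t
    using that w(1,2) wne set_take_subset[of t w] nth_mem[of t w] by (auto simp del: nth_mem)
  define G where "G = (\<lambda>A. 1 + (\<Sum>t=1..<h * L. F A (take t w) (w ! t)))"
  have intG: "integrable M G"
    unfolding G_def using intF wt by (intro Bochner_Integration.integrable_add Bochner_Integration.integrable_sum) auto
  \<comment> \<open>The welfare is bounded by an integrable nonnegative function, so its measurability is not at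
    issue: the integral of a non-integrable function is 0.\<close>
  have "(\<integral>A. social_welfare {..<k} uniform_metric (supply_of A d) d \<partial>M) \<le> (\<integral>A. G A \<partial>M)"
  proof (rule integral_mono'[OF intG])
    fix A assume A: "A \<in> space M"
    show "0 \<le> G A"
      unfolding G_def using F_nonneg[OF A] wt by (intro add_nonneg_nonneg sum_nonneg) auto
    have "social_welfare {..<k} uniform_metric (supply_of A d) d
        \<le> 1 + (\<Sum>t=1..<length d. demand_served {..<k} (A (take t d)) (d ! t))"
      by (rule online_welfare_le[OF _ alg[OF A] dD]) simp
    also have "\<dots> \<le> G A"
      unfolding G_def len F_def
    proof (intro add_left_mono sum_mono)
      fix t assume t: "t \<in> {1..<h * L}"
      have "d ! t = block_demand n (w ! t)" using t w(1) by (simp add: d_def)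
      moreover have "A (take t d) \<in> unit_vectors {..<k}"
        using unit[OF A Dseq[OF wt(2,1)[OF t]]] by (simp add: d_def take_map)
      ultimately show "demand_served {..<k} (A (take t d)) (d ! t)
          \<le> (\<Sum>v = w ! t * n..<w ! t * n + n. A (map (block_demand n) (take t w)) v)"
        using demand_served_block[OF mn wt(3)[OF t]] by (simp add: d_def take_map)
    qed
    finally show "social_welfare {..<k} uniform_metric (supply_of A d) d \<le> G A" .
  qed
  also have "(\<integral>A. G A \<partial>M) = 1 + (\<Sum>t=1..<h * L. \<integral>A. F A (take t w) (w ! t) \<partial>M)"
    unfolding G_def using intF wt
    by (subst Bochner_Integration.integral_add) (auto simp: prob_space intro!: Bochner_Integration.integral_sum)
  also have "(\<Sum>t=1..<h * L. \<integral>A. F A (take t w) (w ! t) \<partial>M) = (\<Sum>t=1..<h * L. P (take t w) (w ! t))"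
    using wt by (intro sum.cong) (auto simp: P_def)
  also have "\<dots> \<le> history_cost P w"
    unfolding history_cost_def w(1) by (intro sum_mono2) (auto simp: P_nonneg)
  also have "\<dots> \<le> real h * (real h / real (m - h + 1) + 1 / real h)" by (rule w(4))
  also have "\<dots> \<le> 3"
  proof -
    have "real (m - h + 1) = real h ^ 2 - real h + 1" using hm by (simp add: m_def of_nat_diff)
    \<comment> \<open>The difference of the two sides is \<open>(h - 1) ^ 2 + 1\<close>.\<close>
    moreover have "real h ^ 2 \<le> 2 * (real h ^ 2 - real h + 1)"
      using zero_le_power2[of "real h - 1"] by (simp add: power2_eq_square algebra_simps)
    moreover have "0 < real h ^ 2" using h by simp
    ultimately have "real h ^ 2 / real (m - h + 1) \<le> 2" by (simp add: divide_le_eq)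
    then show ?thesis using h by (simp add: power2_eq_square distrib_left)
  qed
  finally have num: "(\<integral>A. social_welfare {..<k} uniform_metric (supply_of A d) d \<partial>M) \<le> 4" by simp
  have "competitive_ratio {..<k} uniform_metric D M
      \<le> ereal ((\<integral>A. social_welfare {..<k} uniform_metric (supply_of A d) d \<partial>M)
          / optimal_welfare {..<k} uniform_metric d)"
    unfolding competitive_ratio_def by (rule INF_lower[OF dD])
  also have "\<dots> \<le> ereal (4 / real h)"
  proof -
    \<comment> \<open>The expected welfare may be negative, so it is replaced by 4 before the
      denominator is lowered to \<open>h\<close>.\<close>
    have "(\<integral>A. social_welfare {..<k} uniform_metric (supply_of A d) d \<partial>M)
          / optimal_welfare {..<k} uniform_metric d \<le> 4 / optimal_welfare {..<k} uniform_metric d"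
      using num opt h by (intro divide_right_mono) auto
    also have "\<dots> \<le> 4 / real h" using opt h by (intro divide_left_mono) auto
    finally show ?thesis by simp
  qed
  finally show ?thesis unfolding D_def .
qed

section \<open>Rounding of the parameters and the absolute constant\<close>

theorem theorem5p11:
  "\<exists>c::real. 0 < c \<and>
     (\<forall>(k::nat) (\<rho>::real) (M :: nat algorithm measure).
        1 \<le> \<rho> \<longrightarrow> \<rho> \<le> real k \<longrightarrow>
        randomized_online_algorithm {..<k} (capped_demands {..<k} \<rho>) M \<longrightarrow>
        competitive_ratio {..<k} uniform_metric (capped_demands {..<k} \<rho>) M
          \<le> ereal (c * sqrt (\<rho> / real k)))"
proof (intro exI[of _ 12] conjI allI impI)
  fix k :: nat and \<rho> :: real and M :: "nat algorithm measure"
  assume \<rho>: "1 \<le> \<rho>" "\<rho> \<le> real k"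
    and M: "randomized_online_algorithm {..<k} (capped_demands {..<k} \<rho>) M"
  \<comment> \<open>\<open>n\<close> is the least block size whose uniform demand respects the cap
    \<open>1 / \<rho>\<close>, and \<open>h\<close> is the largest integer with
    \<open>h ^ 2 * n \<le> k\<close>. As \<open>k\<close> is an integer,
    \<open>\<rho> \<le> k\<close> gives \<open>n \<le> k\<close> and thus
    \<open>h \<ge> 1\<close>.\<close>
  define n where "n = nat \<lceil>\<rho>\<rceil>"
  define h where "h = nat \<lfloor>sqrt (real k / real n)\<rfloor>"
  have n: "\<rho> \<le> real n" "real n < \<rho> + 1" "n \<le> k"
    using \<rho> unfolding n_def by (linarith, linarith, simp add: nat_le_iff ceiling_le_iff)
  have n0: "0 < real n" using n \<rho> by linarith
  have q: "1 \<le> real k / real n" using n n0 by simp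
  have h1: "0 < h" using q by (simp add: h_def)
  have hle: "real h \<le> sqrt (real k / real n)" using q unfolding h_def by simp
  have hgt: "sqrt (real k / real n) < real h + 1" unfolding h_def by linarith
  have "real h ^ 2 \<le> real k / real n"
    using hle q by (simp add: real_le_rsqrt real_le_lsqrt power_mono sqrt_ge_absD)
  then have "real (h ^ 2 * n) \<le> real k" using n0 by (simp add: field_simps)
  then have hk: "h ^ 2 * n \<le> k" by linarith
  \<comment> \<open>Each rounding loses at most a factor 2: \<open>h + 1 \<le> 2 * h\<close> since
    \<open>h \<ge> 1\<close>, and below \<open>n < \<rho> + 1 \<le> 2 * \<rho>\<close> since
    \<open>\<rho> \<ge> 1\<close>.\<close>
  have "sqrt (real k / real n) \<le> 2 * real h" using hgt h1 by linarith
  then have "real k / real n \<le> (2 * real h) ^ 2" by (rule sqrt_le_D)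
  then have "real k \<le> (2 * real h) ^ 2 * real n" using n0 by (simp add: field_simps)
  also have "\<dots> \<le> (2 * real h) ^ 2 * (2 * \<rho>)" using n \<rho> by (intro mult_left_mono) auto
  finally have k: "real k \<le> 8 * (real h ^ 2 * \<rho>)" by (simp add: power_mult_distrib)
  \<comment> \<open>The bound on \<open>k\<close> gives the factor \<open>16 * 8 = 128\<close>,
    which is rounded up to the square of 12.\<close>
  have "(4 / real h) ^ 2 \<le> 144 * (\<rho> / real k)"
  proof -
    have "0 \<le> real h ^ 2 * \<rho>" using \<rho> by simp
    with k have "16 * real k \<le> 144 * (real h ^ 2 * \<rho>)" by linarith
    then show ?thesis using h1 \<rho> by (simp add: field_simps)
  qed
  then have "4 / real h \<le> sqrt (144 * (\<rho> / real k))" by (rule real_le_rsqrt)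
  also have "\<dots> = 12 * sqrt (\<rho> / real k)"
    using real_sqrt_abs[of 12] unfolding real_sqrt_mult by simp
  finally have "4 / real h \<le> 12 * sqrt (\<rho> / real k)" .
  moreover have "competitive_ratio {..<k} uniform_metric (capped_demands {..<k} \<rho>) M \<le> ereal (4 / real h)"
    using competitive_ratio_le[OF M _ n(1) h1 hk] \<rho> by simp
  ultimately show "competitive_ratio {..<k} uniform_metric (capped_demands {..<k} \<rho>) M
      \<le> ereal (12 * sqrt (\<rho> / real k))"
    by (meson ereal_less_eq(3) order_trans)
qed simp

end
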